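(* Let $\theta\in(0,1]$, $r=1$, and let $\{Z_n\}_{n\ge0}$ be a GW$^{\,\theta}$-process with parameters $(\theta,1,a_n,c_n)_{n\ge1}$. If $A_n\to\infty$ and $B_n\to B\in[0,\infty)$, then $q=1$, $$\mathrm{P}(Z_n>0)\sim(1+B)^{-1/\theta}A_n^{-1/\theta},\qquad \mathrm{E}(Z_n|Z_n>0)\to(1+B)^{1/\theta},$$ and $$\mathrm{E}(s^{Z_n}|Z_n>0)\to 1-((1+B)(1-s)^{-\theta}+B+B^2)^{-1/\theta},\quad 0\le s\le1.$$
   Context: All limits and asymptotic equivalences are as $n\to\infty$. Let $\theta\in(0,1]$, $r=1$, and let $(a_n,c_n)_{n\ge1}$ be real sequences with $0<a_n<\infty$, $c_n>0$, $c_n\ge 1-a_n$ for all $n\ge1$. Put $$f_n(s)=1-(a_n(1-s)^{-\theta}+c_n)^{-1/\theta},\quad 0\le s<1,\qquad f_n(1)=1.$$ Each $f_n(s)=\sum_{j\ge0}p_n(j)s^j$ is a probability generating function. The GW$^{\,\theta}$-process with parameters $(\theta,1,a_n,c_n)_{n\ge1}$ is the Galton-Watson process in a varying environment $\{Z_n\}_{n\ge0}$ with $Z_0=1$, $Z_n=\sum_{i=1}^{Z_{n-1}}X_{n,i}$, where $\{X_{n,i}\}_{n,i\ge1}$ are independent and $\mathrm{P}(X_{n,i}=j)=p_n(j)$. Thus $\mathrm{E}(s^{Z_n})=f_1\circ\cdots\circ f_n(s)$. The extinction probability is $q=\lim \mathrm{P}(Z_n=0)$. Notation: $A_0=1$,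 $A_n=\prod_{i=1}^n a_i$, $C_n=\sum_{i=1}^n A_{i-1}c_i$, $B_n=C_n/A_n$. Conventions: $0^{-\theta}=\infty$, $\infty^{-1/\theta}=0$.
   Formalization: The last limit is corrected to 1-(((1-s)^{-θ}+B)/(1+B))^{-1/θ}; the printed formula fails for B>0 (at s=0 the conditional expectation is 0, but the printed value is 1-(1+B)^{-2/θ}>0, e.g. θ=1, a_n=2, c_n=1 gives 3/4). The two agree for B=0. *)

theory Defs
  imports "HOL-Probability.Probability" "HOL-Library.Landau_Symbols"
begin

text \<open>
  The value at \<open>s = 1\<close> is given separately: it is the one forced by the conventions
  \<open>0^(-\<theta>) = \<infinity>\<close> and \<open>\<infinity>^(-1/\<theta>) = 0\<close>, whereas \<open>0 powr x = 0\<close> in the library.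
\<close>
definition theta_pgf :: "real \<Rightarrow> real \<Rightarrow> real \<Rightarrow> real \<Rightarrow> real" where
  "theta_pgf \<theta> a c s =
     (if s = 1 then 1 else 1 - (a * (1 - s) powr (- \<theta>) + c) powr (- 1 / \<theta>))"

text \<open>
  \<open>X n i\<close> is the number of children of the \<open>i\<close>-th individual of generation \<open>n - 1\<close>.
  Generations and individuals are numbered from 1, so \<open>X\<close> and all parameter sequences
  are unconstrained (and irrelevant) at index 0.
\<close>
primrec gw_size :: "(nat \<Rightarrow> nat \<Rightarrow> 'w \<Rightarrow> nat) \<Rightarrow> nat \<Rightarrow> 'w \<Rightarrow> nat" where
  "gw_size X 0 \<omega> = 1"
| "gw_size X (Suc n) \<omega> = (\<Sum>i = 1..gw_size X n \<omega>. X (Suc n) i \<omega>)"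

locale gw_varying_env = prob_space M
  for M :: "'w measure" +
  fixes p :: "nat \<Rightarrow> nat \<Rightarrow> real"
    and X :: "nat \<Rightarrow> nat \<Rightarrow> 'w \<Rightarrow> nat"
  assumes offspring_indep:
      "indep_vars (\<lambda>_. count_space UNIV) (\<lambda>(n, i). X n i) ({1..} \<times> {1..})"
    and offspring_law:
      "\<And>n i j. n \<ge> 1 \<Longrightarrow> i \<ge> 1 \<Longrightarrow> prob {\<omega> \<in> space M. X n i \<omega> = j} = p n j"

locale gw_theta_process = gw_varying_env M p X
  for M :: "'w measure"
    and p :: "nat \<Rightarrow> nat \<Rightarrow> real"
    and X :: "nat \<Rightarrow> nat \<Rightarrow> 'w \<Rightarrow> nat" +
  fixes \<theta> :: real
    and a c :: "nat \<Rightarrow> real"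
  assumes theta_pos: "0 < \<theta>"
    and theta_le_1: "\<theta> \<le> 1"
    and a_pos: "\<And>n. n \<ge> 1 \<Longrightarrow> 0 < a n"
    and c_pos: "\<And>n. n \<ge> 1 \<Longrightarrow> 0 < c n"
    and c_ge: "\<And>n. n \<ge> 1 \<Longrightarrow> c n \<ge> 1 - a n"
    and offspring_pgf:
      "\<And>n s. n \<ge> 1 \<Longrightarrow> 0 \<le> s \<Longrightarrow> s \<le> 1 \<Longrightarrow>
         (\<lambda>j. p n j * s ^ j) sums theta_pgf \<theta> (a n) (c n) s"

definition extinction_prob :: "'w measure \<Rightarrow> (nat \<Rightarrow> 'w \<Rightarrow> nat) \<Rightarrow> real" where
  "extinction_prob M Z = lim (\<lambda>n. \<P>(\<omega> in M. Z n \<omega> = 0))"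

definition cond_expectation_on :: "'w measure \<Rightarrow> ('w \<Rightarrow> bool) \<Rightarrow> ('w \<Rightarrow> real) \<Rightarrow> real" where
  "cond_expectation_on M Q Y = integral\<^sup>L (uniform_measure M {\<omega> \<in> space M. Q \<omega>}) Y"

definition env_A :: "(nat \<Rightarrow> real) \<Rightarrow> nat \<Rightarrow> real" where
  "env_A a n = (\<Prod>i = 1..n. a i)"

definition env_C :: "(nat \<Rightarrow> real) \<Rightarrow> (nat \<Rightarrow> real) \<Rightarrow> nat \<Rightarrow> real" where
  "env_C a c n = (\<Sum>i = 1..n. env_A a (i - 1) * c i)"

definition env_B :: "(nat \<Rightarrow> real) \<Rightarrow> (nat \<Rightarrow> real) \<Rightarrow> nat \<Rightarrow> real" where
  "env_B a c n = env_C a c n / env_A a n"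

end

theory Submission
  imports Defs
begin

text \<open>
  The functions \<open>f\<^sub>n\<close> are affine in the coordinate \<open>u = (1 - s)^(-\<theta>)\<close>, so their composition
  is of the same form, \<open>E(s^Z\<^sub>n) = 1 - (A\<^sub>n u + C\<^sub>n)^(-1/\<theta>)\<close>. Its value at 0 gives the survival
  probability \<open>(A\<^sub>n (1 + B\<^sub>n))^(-1/\<theta>)\<close> and its derivative at 1 the mean \<open>A\<^sub>n^(-1/\<theta>)\<close>.
  In the conditional quantities the factor \<open>A\<^sub>n\<close> cancels, leaving explicit continuous
  functions of \<open>B\<^sub>n\<close>.
\<close>

section \<open>Integrals\<close>

text \<open>The density of \<open>uniform_measure\<close> is an extended nonnegative quotient. As
  the measure of \<open>S\<close> is neither 0 nor infinite, it is the image of a real quotient, to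
  which \<open>integral_density\<close> applies.\<close>

lemma integral_uniform_measure:
  fixes f :: "'a \<Rightarrow> real"
  assumes "f \<in> borel_measurable M" "S \<in> sets M" "emeasure M S \<noteq> 0" "emeasure M S \<noteq> \<infinity>"
  shows "integral\<^sup>L (uniform_measure M S) f = (\<integral>x. indicator S x * f x \<partial>M) / measure M S"
proof -
  have "indicator S x / emeasure M S = ennreal (indicator S x / measure M S)" for x
    using assms(3,4)
    by (cases "x \<in> S") (auto simp: emeasure_eq_ennreal_measure ennreal_1[symmetric]
        divide_ennreal zero_less_measure_iff simp del: ennreal_1)
  then have "uniform_measure M S = density M (\<lambda>x. ennreal (indicator S x / measure M S))"
    by (simp add: uniform_measure_def)
  with assms(1,2) show ?thesis
    by (simp add: integral_density)
qed

text \<open>Independence makes the joint law a product of probability measures, and a bounded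
  function is integrable there, so Fubini applies. The two sample points on the right let the first
  variable be frozen while averaging over the second.\<close>

lemma (in prob_space) expectation_indep_var_Fubini:
  fixes \<phi> :: "'b \<times> 'b \<Rightarrow> real"
  assumes indep: "indep_var S U T V"
    and \<phi>: "\<phi> \<in> borel_measurable (S \<Otimes>\<^sub>M T)"
    and bound: "\<And>x. \<bar>\<phi> x\<bar> \<le> K"
  shows "expectation (\<lambda>\<omega>. \<phi> (U \<omega>, V \<omega>)) = expectation (\<lambda>\<omega>. expectation (\<lambda>\<omega>'. \<phi> (U \<omega>, V \<omega>')))"
proof -
  have U[measurable]: "random_variable S U" and V[measurable]: "random_variable T V"
    and eq: "distr M S U \<Otimes>\<^sub>M distr M T V = distr M (S \<Otimes>\<^sub>M T) (\<lambda>x. (U x, V x))"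
    using indep unfolding indep_var_distribution_eq by auto
  note \<phi>[measurable]
  interpret U: prob_space "distr M S U" by (rule prob_space_distr) fact
  interpret V: prob_space "distr M T V" by (rule prob_space_distr) fact
  interpret UV: pair_prob_space "distr M S U" "distr M T V" ..
  have int: "integrable (distr M S U \<Otimes>\<^sub>M distr M T V) \<phi>"
    by (rule UV.P.integrable_const_bound[of _ K]) (use bound in auto)
  have "expectation (\<lambda>\<omega>. \<phi> (U \<omega>, V \<omega>)) = integral\<^sup>L (distr M (S \<Otimes>\<^sub>M T) (\<lambda>x. (U x, V x))) \<phi>"
    by (simp add: integral_distr)
  also have "\<dots> = (\<integral>x. (\<integral>y. \<phi> (x, y) \<partial>distr M T V) \<partial>distr M S U)"
    using UV.integral_fst'[OF int] by (simp add: eq)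
  also have "\<dots> = expectation (\<lambda>\<omega>. \<integral>y. \<phi> (U \<omega>, y) \<partial>distr M T V)"
    by (subst integral_distr) auto
  also have "\<dots> = expectation (\<lambda>\<omega>. expectation (\<lambda>\<omega>'. \<phi> (U \<omega>, V \<omega>')))"
    by (intro Bochner_Integration.integral_cong refl integral_distr)
      (use measurable_space[OF U] in auto)
  finally show ?thesis .
qed

text \<open>Exactly one indicator in the expansion over the values of \<open>N\<close> is nonzero.
  Working with nonnegative integrals allows sum and integral to be exchanged without a prior
  integrability argument.\<close>

lemma (in prob_space) expectation_power_eq_pgf:
  fixes N :: "'a \<Rightarrow> nat"
  assumes N[measurable]: "N \<in> M \<rightarrow>\<^sub>M count_space UNIV"
    and "0 \<le> s"
    and sums: "(\<lambda>j. prob {\<omega> \<in> space M. N \<omega> = j} * s ^ j) sums L"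
  shows "expectation (\<lambda>\<omega>. s ^ N \<omega>) = L"
proof -
  have "(\<integral>\<^sup>+\<omega>. ennreal (s ^ N \<omega>) \<partial>M)
      = (\<integral>\<^sup>+\<omega>. (\<Sum>j. ennreal (s ^ j) * indicator {\<omega> \<in> space M. N \<omega> = j} \<omega>) \<partial>M)"
  proof (rule nn_integral_cong)
    fix \<omega> assume "\<omega> \<in> space M"
    then have "(\<Sum>j. ennreal (s ^ j) * indicator {\<omega> \<in> space M. N \<omega> = j} \<omega>)
        = (\<Sum>j\<in>{N \<omega>}. ennreal (s ^ j) * indicator {\<omega> \<in> space M. N \<omega> = j} \<omega>)"
      by (intro suminf_finite) auto
    with \<open>\<omega> \<in> space M\<close> show "ennreal (s ^ N \<omega>) = (\<Sum>j. ennreal (s ^ j) * indicator {\<omega> \<in> space M. N \<omega> = j} \<omega>)"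
      by simp
  qed
  also have "\<dots> = (\<Sum>j. \<integral>\<^sup>+\<omega>. ennreal (s ^ j) * indicator {\<omega> \<in> space M. N \<omega> = j} \<omega> \<partial>M)"
    by (rule nn_integral_suminf) measurable
  also have "\<dots> = (\<Sum>j. ennreal (prob {\<omega> \<in> space M. N \<omega> = j} * s ^ j))"
    using \<open>0 \<le> s\<close>
    by (simp add: nn_integral_cmult_indicator emeasure_eq_measure ennreal_mult' mult.commute)
  also have "\<dots> = ennreal L"
    using sums \<open>0 \<le> s\<close> by (intro suminf_ennreal_eq) auto
  finally have nn: "(\<integral>\<^sup>+\<omega>. ennreal (s ^ N \<omega>) \<partial>M) = ennreal L" .
  have "0 \<le> L"
    using sums_le[OF _ sums_zero sums] \<open>0 \<le> s\<close> by simp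
  with nn show ?thesis
    using \<open>0 \<le> s\<close> by (subst integral_eq_nn_integral) auto
qed

text \<open>Monotone convergence in \<open>(1 - s^N) / (1 - s) = 1 + s + \<dots> + s^(N - 1)\<close> along \<open>s = k / (k + 1)\<close>.\<close>

lemma (in prob_space) expectation_eq_pgf_deriv_at_1:
  fixes N :: "'a \<Rightarrow> nat"
  assumes N[measurable]: "N \<in> M \<rightarrow>\<^sub>M count_space UNIV"
    and lim: "((\<lambda>s. (1 - expectation (\<lambda>\<omega>. s ^ N \<omega>)) / (1 - s)) \<longlongrightarrow> L) (at_left 1)"
  shows "expectation (\<lambda>\<omega>. real (N \<omega>)) = L"
proof -
  define s where "s k = real k / real (Suc k)" for k
  have s: "0 \<le> s k" "s k < 1" for k
    by (auto simp: s_def)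
  have "s \<longlonglongrightarrow> 1"
    unfolding s_def by (rule LIMSEQ_n_over_Suc_n)
  have mono: "mono s"
    unfolding s_def by (auto intro!: monoI simp: field_simps)
  have "filterlim s (at_left 1) sequentially"
    using \<open>s \<longlonglongrightarrow> 1\<close> s by (auto simp: filterlim_at less_imp_neq)
  from filterlim_compose[OF lim this]
  have lim_s: "(\<lambda>k. (1 - expectation (\<lambda>\<omega>. s k ^ N \<omega>)) / (1 - s k)) \<longlonglongrightarrow> L" .
  have pow_int: "integrable M (\<lambda>\<omega>. s k ^ N \<omega>)" for k
    by (rule integrable_const_bound[of _ 1]) (use s[of k] in \<open>auto simp: power_le_one\<close>)
  have geo: "(\<Sum>j<N \<omega>. s k ^ j) = (1 - s k ^ N \<omega>) / (1 - s k)" for k \<omega>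
    using s[of k] by (simp add: sum_gp_strict)
  \<comment> \<open>Integrability of \<open>N\<close> is not assumed: it comes out of monotone
    convergence, because the integrals of the geometric sums converge to the finite
    \<open>L\<close>.\<close>
  have "has_bochner_integral M (\<lambda>\<omega>. real (N \<omega>)) L"
  proof (rule has_bochner_integral_monotone_convergence)
    show "integrable M (\<lambda>\<omega>. \<Sum>j<N \<omega>. s k ^ j)" for k
      unfolding geo using pow_int[of k] by simp
    show "AE \<omega> in M. mono (\<lambda>k. \<Sum>j<N \<omega>. s k ^ j)"
      using s mono by (auto intro!: AE_I2 monoI sum_mono power_mono dest: monoD)
    have "(\<lambda>k. \<Sum>j<N \<omega>. s k ^ j) \<longlonglongrightarrow> (\<Sum>j<N \<omega>. 1 ^ j)" for \<omega>
      by (intro tendsto_intros \<open>s \<longlonglongrightarrow> 1\<close>)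
    then show "AE \<omega> in M. (\<lambda>k. \<Sum>j<N \<omega>. s k ^ j) \<longlonglongrightarrow> real (N \<omega>)"
      by simp
    show "(\<lambda>k. \<integral>\<omega>. (\<Sum>j<N \<omega>. s k ^ j) \<partial>M) \<longlonglongrightarrow> L"
      unfolding geo using lim_s pow_int by (simp add: prob_space)
  qed measurable
  then show ?thesis
    by (rule has_bochner_integral_integral_eq)
qed

section \<open>The functions \<open>theta_pgf\<close>\<close>

lemma theta_pgf_base_ge_1:
  assumes "0 < \<theta>" "0 < a" "1 - a \<le> c" "0 \<le> s" "s < (1 :: real)"
  shows "1 \<le> a * (1 - s) powr (- \<theta>) + c"
proof -
  have "1 \<le> (1 - s) powr (- \<theta>)"
    using assms powr_mono2'[of "- \<theta>" "1 - s" 1] by simp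
  then have "a * 1 \<le> a * (1 - s) powr (- \<theta>)"
    using assms by (intro mult_left_mono) auto
  then show ?thesis
    using assms by linarith
qed

text \<open>Keeps the value of one generating function inside [0,1], so that it can serve as the
  argument of the next.\<close>

lemma theta_pgf_bounds:
  assumes "0 < \<theta>" "0 < a" "1 - a \<le> c" "0 \<le> s" "s \<le> 1"
  shows "0 \<le> theta_pgf \<theta> a c s" "theta_pgf \<theta> a c s \<le> 1"
proof -
  show "theta_pgf \<theta> a c s \<le> 1"
    by (simp add: theta_pgf_def)
  show "0 \<le> theta_pgf \<theta> a c s"
  proof (cases "s = 1")
    case False
    with assms have "1 \<le> a * (1 - s) powr (- \<theta>) + c"
      by (intro theta_pgf_base_ge_1) auto
    then have "(a * (1 - s) powr (- \<theta>) + c) powr (- 1 / \<theta>) \<le> 1"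
      using powr_mono2'[of "- 1 / \<theta>" 1 "a * (1 - s) powr (- \<theta>) + c"] assms by simp
    with False show ?thesis
      by (simp add: theta_pgf_def)
  qed (simp add: theta_pgf_def)
qed

lemma theta_pgf_id:
  assumes "0 < \<theta>" "s \<le> 1"
  shows "theta_pgf \<theta> 1 0 s = s"
  using assms by (simp add: theta_pgf_def powr_powr)

lemma theta_pgf_comp:
  assumes "0 < \<theta>" "0 < a" "1 - a \<le> c" "0 \<le> s" "s \<le> 1"
  shows "theta_pgf \<theta> A C (theta_pgf \<theta> a c s) = theta_pgf \<theta> (A * a) (C + A * c) s"
proof (cases "s = 1")
  case False
  define y where "y = a * (1 - s) powr (- \<theta>) + c"
  \<comment> \<open>Positivity of \<open>y\<close> makes the inner value differ from 1, so the outer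
    function is evaluated by its power formula and not by its special value.\<close>
  have "y > 0"
    using theta_pgf_base_ge_1[of \<theta> a c s] assms False by (simp add: y_def)
  have "theta_pgf \<theta> a c s = 1 - y powr (- 1 / \<theta>)"
    using False by (simp add: theta_pgf_def y_def)
  moreover have "(y powr (- 1 / \<theta>)) powr (- \<theta>) = y"
    using \<open>y > 0\<close> assms by (simp add: powr_powr)
  ultimately have "theta_pgf \<theta> A C (theta_pgf \<theta> a c s) = 1 - (A * y + C) powr (- 1 / \<theta>)"
    using \<open>y > 0\<close> by (simp add: theta_pgf_def)
  with False show ?thesis
    by (simp add: theta_pgf_def y_def algebra_simps)
qed (simp add: theta_pgf_def)

text \<open>Pull (1 - s)^(-\<theta>) out of the base: its power -1/\<theta> is exactly 1 - s and
  cancels the denominator. What remains, (A + C (1 - s)^\<theta>)^(-1/\<theta>), extends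
  continuously to s = 1.\<close>

lemma theta_pgf_deriv_at_1:
  assumes "0 < \<theta>" "0 < A" "0 \<le> C"
  shows "((\<lambda>s. (1 - theta_pgf \<theta> A C s) / (1 - s)) \<longlongrightarrow> A powr (- 1 / \<theta>)) (at_left 1)"
proof -
  have "((\<lambda>s. (A + C * (1 - s) powr \<theta>) powr (- 1 / \<theta>)) \<longlongrightarrow> (A + C * 0) powr (- 1 / \<theta>)) (at_left 1)"
  proof (intro tendsto_intros)
    \<comment> \<open>The base tends to 0, so continuity here rests on the positive exponent and on
      the base being nonnegative to the left of 1.\<close>
    have "((\<lambda>s. (1 - s) powr \<theta>) \<longlongrightarrow> (1 - 1) powr \<theta>) (at_left (1 :: real))"
      using \<open>0 < \<theta>\<close>
      by (intro tendsto_powr' tendsto_intros) (auto simp: eventually_at_filter)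
    then show "((\<lambda>s. (1 - s) powr \<theta>) \<longlongrightarrow> 0) (at_left (1 :: real))"
      using \<open>0 < \<theta>\<close> by simp
  qed (use assms in auto)
  moreover have "eventually (\<lambda>s. (A + C * (1 - s) powr \<theta>) powr (- 1 / \<theta>)
      = (1 - theta_pgf \<theta> A C s) / (1 - s)) (at_left 1)"
  proof (rule eventually_at_leftI)
    fix s :: real assume "s \<in> {0<..<1}"
    then have s: "0 < 1 - s" by simp
    have "(A * (1 - s) powr (- \<theta>) + C) = (A + C * (1 - s) powr \<theta>) * (1 - s) powr (- \<theta>)"
      using s by (simp add: algebra_simps flip: powr_add)
    also have "\<dots> powr (- 1 / \<theta>) = (A + C * (1 - s) powr \<theta>) powr (- 1 / \<theta>) * (1 - s)"
      using s assms by (simp add: powr_mult powr_powr)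
    finally show "(A + C * (1 - s) powr \<theta>) powr (- 1 / \<theta>)
        = (1 - theta_pgf \<theta> A C s) / (1 - s)"
      using s by (simp add: theta_pgf_def)
  qed simp
  ultimately show ?thesis
    by (auto intro: Lim_transform_eventually)
qed

section \<open>The process\<close>

text \<open>The two sample points may lie in different spaces. This transfers the generation size
  from the sample space to the space of families of offspring numbers.\<close>

lemma gw_size_cong:
  assumes "\<And>m i. 1 \<le> m \<Longrightarrow> m \<le> n \<Longrightarrow> 1 \<le> i \<Longrightarrow> X m i \<omega> = Y m i \<omega>'"
  shows "gw_size X n \<omega> = gw_size Y n \<omega>'"
  using assms by (induction n) (auto intro!: sum.cong)

lemma measurable_sum_count_space:
  fixes f :: "'i \<Rightarrow> 'w \<Rightarrow> nat"
  assumes "\<And>i. i \<in> I \<Longrightarrow> f i \<in> N \<rightarrow>\<^sub>M count_space UNIV"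
  shows "(\<lambda>\<omega>. \<Sum>i\<in>I. f i \<omega>) \<in> N \<rightarrow>\<^sub>M count_space UNIV"
  using assms
proof (induction I rule: infinite_finite_induct)
  case (insert x I)
  have "(\<lambda>\<omega>. f x \<omega> + (\<Sum>i\<in>I. f i \<omega>)) \<in> N \<rightarrow>\<^sub>M count_space UNIV"
    by (rule measurable_compose_countable[where f = "\<lambda>k \<omega>. k + (\<Sum>i\<in>I. f i \<omega>)"])
      (use insert in \<open>auto intro!: measurable_compose[OF _ measurable_count_space]\<close>)
  then show ?case
    using insert by simp
qed auto

text \<open>Stated for an arbitrary measure space \<open>N\<close>, since it is applied both to
  \<open>M\<close> and to a product space of offspring numbers.\<close>

lemma measurable_gw_size:
  assumes "\<And>m i. 1 \<le> m \<Longrightarrow> m \<le> n \<Longrightarrow> 1 \<le> i \<Longrightarrow> X m i \<in> N \<rightarrow>\<^sub>M count_space UNIV"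
  shows "gw_size X n \<in> N \<rightarrow>\<^sub>M count_space UNIV"
  using assms
proof (induction n)
  case (Suc n)
  have "(\<lambda>\<omega>. \<Sum>i = 1..gw_size X n \<omega>. X (Suc n) i \<omega>) \<in> N \<rightarrow>\<^sub>M count_space UNIV"
  proof (rule measurable_compose_countable[where f = "\<lambda>k \<omega>. \<Sum>i = 1..k. X (Suc n) i \<omega>"])
    show "(\<lambda>\<omega>. \<Sum>i = 1..k. X (Suc n) i \<omega>) \<in> N \<rightarrow>\<^sub>M count_space UNIV" for k
      by (rule measurable_sum_count_space) (use Suc.prems in auto)
  qed (use Suc in auto)
  then show ?case
    by simp
next
  case 0
  have "gw_size X 0 = (\<lambda>_. 1)"
    by (simp add: fun_eq_iff)
  then show ?case
    by simp
qed

section \<open>General varying environments: recursion for generating functions, conditioning on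
  survival\<close>

context gw_varying_env
begin

lemma offspring_measurable: "n \<ge> 1 \<Longrightarrow> i \<ge> 1 \<Longrightarrow> X n i \<in> M \<rightarrow>\<^sub>M count_space UNIV"
  using offspring_indep unfolding indep_vars_def by auto

lemma gw_size_measurable [measurable]: "gw_size X n \<in> M \<rightarrow>\<^sub>M count_space UNIV"
  by (rule measurable_gw_size) (rule offspring_measurable)

lemma expectation_power_offspring_sum:
  fixes s f :: real
  assumes "n \<ge> 1" "\<And>i. i \<ge> 1 \<Longrightarrow> expectation (\<lambda>\<omega>. s ^ X n i \<omega>) = f" "0 \<le> s" "s \<le> 1"
  shows "expectation (\<lambda>\<omega>. s ^ (\<Sum>i = 1..k. X n i \<omega>)) = f ^ k"
proof -
  note [measurable] = offspring_measurable[OF \<open>n \<ge> 1\<close>]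
  have "indep_vars (\<lambda>_. count_space UNIV) (\<lambda>(n, i). X n i) (Pair n ` {1..k})"
    by (rule indep_vars_subset[OF offspring_indep]) (use \<open>n \<ge> 1\<close> in auto)
  then have "indep_vars (\<lambda>_. borel) (\<lambda>x \<omega>. s ^ (case x of (n, i) \<Rightarrow> X n i) \<omega>) (Pair n ` {1..k})"
    by (rule indep_vars_compose2) simp
  moreover have "integrable M (\<lambda>\<omega>. s ^ X n i \<omega>)" if "i \<in> {1..k}" for i
    by (rule integrable_const_bound[of _ 1]) (use that assms in \<open>auto simp: power_le_one\<close>)
  ultimately have "expectation (\<lambda>\<omega>. \<Prod>x\<in>Pair n ` {1..k}. s ^ (case x of (n, i) \<Rightarrow> X n i) \<omega>)
      = (\<Prod>x\<in>Pair n ` {1..k}. expectation (\<lambda>\<omega>. s ^ (case x of (n, i) \<Rightarrow> X n i) \<omega>))"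
    by (intro indep_vars_lebesgue_integral) auto
  then show ?thesis
    using assms by (simp add: power_sum prod.reindex inj_on_def)
qed

text \<open>Conditioning on generation \<open>n\<close>, which is independent of the offspring numbers in generation \<open>n + 1\<close>.\<close>

lemma expectation_power_gw_size_Suc:
  fixes s f :: real
  assumes "\<And>i. i \<ge> 1 \<Longrightarrow> expectation (\<lambda>\<omega>. s ^ X (Suc n) i \<omega>) = f" "0 \<le> s" "s \<le> 1"
  shows "expectation (\<lambda>\<omega>. s ^ gw_size X (Suc n) \<omega>) = expectation (\<lambda>\<omega>. f ^ gw_size X n \<omega>)"
proof -
  \<comment> \<open>\<open>I\<close> indexes all offspring numbers that determine generation
    \<open>n\<close>, \<open>J\<close> those of the next step. The index sets are disjoint, so the
    restricted families \<open>R I\<close> and \<open>R J\<close> are independent.\<close>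
  define I J where "I = {1..n} \<times> {1 :: nat..}" and "J = {Suc n} \<times> {1 :: nat..}"
  define P where "P K = (\<Pi>\<^sub>M x\<in>K. count_space (UNIV :: nat set))" for K :: "(nat \<times> nat) set"
  define R where "R K \<omega> = restrict (\<lambda>x. (case x of (m, i) \<Rightarrow> X m i) \<omega>) K" for K \<omega>
  define Z where "Z = gw_size (\<lambda>m i x. x (m, i)) n"
  define \<phi> where "\<phi> = (\<lambda>(x, y). s ^ (\<Sum>i = 1..Z x. y (Suc n, i)))"
  have ind: "indep_var (P I) (R I) (P J) (R J)"
    unfolding P_def R_def
    by (rule indep_var_restrict[OF offspring_indep]) (auto simp: I_def J_def)
  have "Z \<in> P I \<rightarrow>\<^sub>M count_space UNIV"
    unfolding Z_def P_def
    by (rule measurable_gw_size) (auto simp: I_def intro!: measurable_component_singleton)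
  then have Z: "(\<lambda>x. Z (fst x)) \<in> P I \<Otimes>\<^sub>M P J \<rightarrow>\<^sub>M count_space UNIV"
    by (rule measurable_compose[OF measurable_fst])
  have "(\<lambda>y. \<Sum>i = 1..k. y (Suc n, i)) \<in> P J \<rightarrow>\<^sub>M count_space UNIV" for k
    unfolding P_def
    by (rule measurable_sum_count_space) (auto simp: J_def intro!: measurable_component_singleton)
  then have "(\<lambda>y. s ^ (\<Sum>i = 1..k. y (Suc n, i))) \<in> borel_measurable (P J)" for k
    by (rule measurable_compose) simp
  then have "(\<lambda>x. s ^ (\<Sum>i = 1..k. snd x (Suc n, i))) \<in> borel_measurable (P I \<Otimes>\<^sub>M P J)" for k
    by (rule measurable_compose[OF measurable_snd])
  \<comment> \<open>The random upper limit of the sum takes countably many values, so measurability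
    for each fixed limit \<open>k\<close> suffices.\<close>
  then have \<phi>: "\<phi> \<in> borel_measurable (P I \<Otimes>\<^sub>M P J)"
    unfolding \<phi>_def case_prod_beta by (rule measurable_compose_countable[OF _ Z])
  have "Z (R I \<omega>) = gw_size X n \<omega>" for \<omega>
    unfolding Z_def by (rule gw_size_cong) (auto simp: R_def I_def)
  then have \<phi>_eq: "\<phi> (R I \<omega>, R J \<omega>') = s ^ (\<Sum>i = 1..gw_size X n \<omega>. X (Suc n) i \<omega>')"
    for \<omega> \<omega>'
    by (auto simp: \<phi>_def R_def J_def intro!: arg_cong[of _ _ "power s"] sum.cong)
  have "expectation (\<lambda>\<omega>. \<phi> (R I \<omega>, R J \<omega>))
      = expectation (\<lambda>\<omega>. expectation (\<lambda>\<omega>'. \<phi> (R I \<omega>, R J \<omega>')))"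
    by (rule expectation_indep_var_Fubini[OF ind \<phi>, where K = 1])
      (use assms in \<open>auto simp: \<phi>_def power_le_one\<close>)
  then have "expectation (\<lambda>\<omega>. s ^ gw_size X (Suc n) \<omega>)
      = expectation (\<lambda>\<omega>. expectation (\<lambda>\<omega>'. s ^ (\<Sum>i = 1..gw_size X n \<omega>. X (Suc n) i \<omega>')))"
    by (simp add: \<phi>_eq)
  \<comment> \<open>For fixed outer \<omega> the number of summands is a constant, so the inner
    expectation factorizes.\<close>
  also have "\<dots> = expectation (\<lambda>\<omega>. f ^ gw_size X n \<omega>)"
    using assms by (subst expectation_power_offspring_sum[where f = f]) auto
  finally show ?thesis .
qed

lemma cond_expectation_survival:
  fixes g :: "nat \<Rightarrow> real"
  assumes "prob {\<omega> \<in> space M. gw_size X n \<omega> > 0} \<noteq> 0"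
  shows "cond_expectation_on M (\<lambda>\<omega>. gw_size X n \<omega> > 0) (\<lambda>\<omega>. g (gw_size X n \<omega>))
    = expectation (\<lambda>\<omega>. if gw_size X n \<omega> > 0 then g (gw_size X n \<omega>) else 0)
      / prob {\<omega> \<in> space M. gw_size X n \<omega> > 0}"
proof -
  have "emeasure M {\<omega> \<in> space M. gw_size X n \<omega> > 0} \<noteq> 0"
    using assms by (simp add: emeasure_eq_measure)
  moreover have "expectation (\<lambda>\<omega>. indicator {\<omega> \<in> space M. gw_size X n \<omega> > 0} \<omega> * g (gw_size X n \<omega>))
      = expectation (\<lambda>\<omega>. if gw_size X n \<omega> > 0 then g (gw_size X n \<omega>) else 0)"
    by (rule Bochner_Integration.integral_cong) (auto simp: indicator_def)
  ultimately show ?thesis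
    unfolding cond_expectation_on_def by (subst integral_uniform_measure) auto
qed

end

section \<open>Exact formulas for the \<theta>-process at finite \<open>n\<close>\<close>

context gw_theta_process
begin

lemma env_A_pos: "env_A a n > 0"
  unfolding env_A_def by (rule prod_pos) (use a_pos in auto)

lemma env_C_nonneg: "env_C a c n \<ge> 0"
  unfolding env_C_def
  by (intro sum_nonneg mult_nonneg_nonneg) (use env_A_pos c_pos in \<open>auto intro: less_imp_le\<close>)

lemma env_B_nonneg: "env_B a c n \<ge> 0"
  unfolding env_B_def using env_A_pos[of n] env_C_nonneg[of n] by simp

lemma pgf_gw_size:
  assumes "0 \<le> s" "s \<le> 1"
  shows "expectation (\<lambda>\<omega>. s ^ gw_size X n \<omega>) = theta_pgf \<theta> (env_A a n) (env_C a c n) s"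
  using assms
\<comment> \<open>The newest generation contributes the innermost function, so the induction
  hypothesis is needed at \<open>f\<close> instead of \<open>s\<close>.\<close>
proof (induction n arbitrary: s)
  case 0
  then show ?case
    using theta_pos by (simp add: env_A_def env_C_def theta_pgf_id prob_space)
next
  case (Suc n)
  define f where "f = theta_pgf \<theta> (a (Suc n)) (c (Suc n)) s"
  have "expectation (\<lambda>\<omega>. s ^ X (Suc n) i \<omega>) = f" if "i \<ge> 1" for i
    unfolding f_def
    by (rule expectation_power_eq_pgf)
      (use that Suc.prems offspring_pgf[of "Suc n" s] offspring_law[of "Suc n" i]
        offspring_measurable[of "Suc n" i] in auto)
  then have "expectation (\<lambda>\<omega>. s ^ gw_size X (Suc n) \<omega>) = expectation (\<lambda>\<omega>. f ^ gw_size X n \<omega>)"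
    by (rule expectation_power_gw_size_Suc) (use Suc.prems in auto)
  also have "\<dots> = theta_pgf \<theta> (env_A a n) (env_C a c n) f"
    unfolding f_def
    by (intro Suc.IH theta_pgf_bounds) (use Suc.prems theta_pos a_pos c_ge in auto)
  also have "\<dots> = theta_pgf \<theta> (env_A a n * a (Suc n)) (env_C a c n + env_A a n * c (Suc n)) s"
    unfolding f_def
    by (rule theta_pgf_comp) (use Suc.prems theta_pos a_pos c_ge in auto)
  finally show ?case
    by (simp add: env_A_def env_C_def)
qed

text \<open>Isolates the factor A_n^(-1/\<theta>), which also occurs in the survival probability and
  cancels on conditioning.\<close>

lemma one_minus_pgf:
  assumes "s < 1"
  shows "1 - theta_pgf \<theta> (env_A a n) (env_C a c n) s
    = env_A a n powr (- 1 / \<theta>) * ((1 - s) powr (- \<theta>) + env_B a c n) powr (- 1 / \<theta>)"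
proof -
  have "env_A a n * (1 - s) powr (- \<theta>) + env_C a c n
      = env_A a n * ((1 - s) powr (- \<theta>) + env_B a c n)"
    using env_A_pos[of n] by (simp add: env_B_def algebra_simps)
  then show ?thesis
    using assms env_A_pos[of n] env_B_nonneg[of n] by (simp add: theta_pgf_def powr_mult)
qed

lemma extinct_prob_eq:
  "prob {\<omega> \<in> space M. gw_size X n \<omega> = 0} = 1 - prob {\<omega> \<in> space M. gw_size X n \<omega> > 0}"
  by (subst prob_neg[symmetric]) auto

lemma survival_prob:
  "prob {\<omega> \<in> space M. gw_size X n \<omega> > 0}
    = env_A a n powr (- 1 / \<theta>) * (1 + env_B a c n) powr (- 1 / \<theta>)"
proof -
  \<comment> \<open>Since 0^0 = 1, the power at s = 0 is the indicator of extinction.\<close>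
  have "expectation (\<lambda>\<omega>. 0 ^ gw_size X n \<omega>)
      = expectation (indicat_real {\<omega> \<in> space M. gw_size X n \<omega> = 0})"
    by (rule Bochner_Integration.integral_cong) (auto simp: indicator_def)
  then have "prob {\<omega> \<in> space M. gw_size X n \<omega> = 0} = theta_pgf \<theta> (env_A a n) (env_C a c n) 0"
    using pgf_gw_size[of 0 n] by simp
  with one_minus_pgf[of 0 n] extinct_prob_eq[of n] show ?thesis
    by simp
qed

lemma survival_prob_pos: "prob {\<omega> \<in> space M. gw_size X n \<omega> > 0} > 0"
  unfolding survival_prob using env_A_pos[of n] env_B_nonneg[of n] by simp

lemma expectation_gw_size: "expectation (\<lambda>\<omega>. real (gw_size X n \<omega>)) = env_A a n powr (- 1 / \<theta>)"
proof (rule expectation_eq_pgf_deriv_at_1)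
  have "eventually (\<lambda>s. (1 - theta_pgf \<theta> (env_A a n) (env_C a c n) s) / (1 - s)
      = (1 - expectation (\<lambda>\<omega>. s ^ gw_size X n \<omega>)) / (1 - s)) (at_left (1 :: real))"
    \<comment> \<open>The formula for the generating function is available only on [0,1], which
      suffices for a left limit at 1.\<close>
    by (rule eventually_at_leftI[of 0]) (simp_all add: pgf_gw_size)
  with theta_pgf_deriv_at_1[OF theta_pos env_A_pos env_C_nonneg, of n n]
  show "((\<lambda>s. (1 - expectation (\<lambda>\<omega>. s ^ gw_size X n \<omega>)) / (1 - s))
      \<longlongrightarrow> env_A a n powr (- 1 / \<theta>)) (at_left 1)"
    by (auto intro: Lim_transform_eventually)
qed measurable

lemma cond_expectation_gw_size:
  "cond_expectation_on M (\<lambda>\<omega>. gw_size X n \<omega> > 0) (\<lambda>\<omega>. real (gw_size X n \<omega>))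
    = (1 + env_B a c n) powr (1 / \<theta>)"
proof -
  \<comment> \<open>The integrand already vanishes on extinction, so the restriction leaves the mean
    unchanged.\<close>
  have "expectation (\<lambda>\<omega>. if gw_size X n \<omega> > 0 then real (gw_size X n \<omega>) else 0)
      = env_A a n powr (- 1 / \<theta>)"
    by (subst expectation_gw_size[symmetric]) (auto intro!: Bochner_Integration.integral_cong)
  then show ?thesis
    using env_A_pos[of n] env_B_nonneg[of n] survival_prob_pos[of n]
    by (simp add: cond_expectation_survival survival_prob powr_minus divide_simps)
qed

lemma cond_pgf_gw_size:
  assumes "0 \<le> s" "s < 1"
  shows "cond_expectation_on M (\<lambda>\<omega>. gw_size X n \<omega> > 0) (\<lambda>\<omega>. s ^ gw_size X n \<omega>)
    = 1 - (((1 - s) powr (- \<theta>) + env_B a c n) / (1 + env_B a c n)) powr (- 1 / \<theta>)"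
proof -
  define P where "P = prob {\<omega> \<in> space M. gw_size X n \<omega> > 0}"
  have int: "integrable M (\<lambda>\<omega>. s ^ gw_size X n \<omega>)"
    by (rule integrable_const_bound[of _ 1]) (use assms in \<open>auto simp: power_le_one\<close>)
  \<comment> \<open>On extinction the power equals 1, also for s = 0, so restricting to survival
    subtracts the extinction indicator.\<close>
  have "expectation (\<lambda>\<omega>. if gw_size X n \<omega> > 0 then s ^ gw_size X n \<omega> else 0)
      = expectation (\<lambda>\<omega>. s ^ gw_size X n \<omega> - indicator {\<omega> \<in> space M. gw_size X n \<omega> = 0} \<omega>)"
    by (rule Bochner_Integration.integral_cong) (auto simp: indicator_def)
  also have "\<dots> = expectation (\<lambda>\<omega>. s ^ gw_size X n \<omega>)
      - expectation (indicator {\<omega> \<in> space M. gw_size X n \<omega> = 0})"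
    by (rule Bochner_Integration.integral_diff) (use int in \<open>auto intro!: integrable_real_indicator simp: emeasure_eq_measure\<close>)
  also have "\<dots> = P - (1 - theta_pgf \<theta> (env_A a n) (env_C a c n) s)"
    using assms extinct_prob_eq[of n] by (simp add: pgf_gw_size P_def)
  finally have "cond_expectation_on M (\<lambda>\<omega>. gw_size X n \<omega> > 0) (\<lambda>\<omega>. s ^ gw_size X n \<omega>)
      = (P - (1 - theta_pgf \<theta> (env_A a n) (env_C a c n) s)) / P"
    using survival_prob_pos[of n] by (simp add: cond_expectation_survival P_def)
  also have "\<dots> = 1 - (1 - theta_pgf \<theta> (env_A a n) (env_C a c n) s) / P"
    using survival_prob_pos[of n] by (simp add: P_def diff_divide_distrib)
  also have "(1 - theta_pgf \<theta> (env_A a n) (env_C a c n) s) / P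
      = (((1 - s) powr (- \<theta>) + env_B a c n) / (1 + env_B a c n)) powr (- 1 / \<theta>)"
    unfolding one_minus_pgf[OF \<open>s < 1\<close>] P_def survival_prob
    using env_A_pos[of n] env_B_nonneg[of n] by (simp add: powr_divide)
  finally show ?thesis .
qed

lemma cond_expectation_survival_one:
  "cond_expectation_on M (\<lambda>\<omega>. gw_size X n \<omega> > 0) (\<lambda>\<omega>. 1) = 1"
proof -
  have "expectation (\<lambda>\<omega>. if gw_size X n \<omega> > 0 then 1 else 0)
      = expectation (indicat_real {\<omega> \<in> space M. gw_size X n \<omega> > 0})"
    by (rule Bochner_Integration.integral_cong) (auto simp: indicator_def)
  then show ?thesis
    using survival_prob_pos[of n] cond_expectation_survival[of n "\<lambda>_. 1"] by simp
qed

end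

(* The limit in the last clause is printed in the source as
     1 - ((1+B)(1-s)^(-theta) + B + B^2)^(-1/theta),
   a slip for
     1 - (((1-s)^(-theta) + B) / (1+B))^(-1/theta):
   the factor (1+B) was moved inside the power with the wrong exponent.  The two
   agree for B = 0; for B > 0 the printed one is nonzero at s = 0, where the
   conditional expectation is 0.  The corrected limit is stated here. *)
theorem theorem4:
  fixes M :: "'w measure"
    and p :: "nat \<Rightarrow> nat \<Rightarrow> real"
    and X :: "nat \<Rightarrow> nat \<Rightarrow> 'w \<Rightarrow> nat"
    and \<theta> B :: real
    and a c :: "nat \<Rightarrow> real"
  defines "Z \<equiv> gw_size X"
  assumes "gw_theta_process M p X \<theta> a c"
    and "filterlim (env_A a) at_top sequentially"
    and "env_B a c \<longlonglongrightarrow> B"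
    and "0 \<le> B"
  shows "extinction_prob M Z = 1
    \<and> (\<lambda>n. \<P>(\<omega> in M. Z n \<omega> > 0))
        \<sim>[sequentially] (\<lambda>n. (1 + B) powr (- 1 / \<theta>) * env_A a n powr (- 1 / \<theta>))
    \<and> (\<lambda>n. cond_expectation_on M (\<lambda>\<omega>. Z n \<omega> > 0) (\<lambda>\<omega>. real (Z n \<omega>)))
        \<longlonglongrightarrow> (1 + B) powr (1 / \<theta>)
    \<and> (\<forall>s. 0 \<le> s \<and> s \<le> 1 \<longrightarrow>
         (\<lambda>n. cond_expectation_on M (\<lambda>\<omega>. Z n \<omega> > 0) (\<lambda>\<omega>. s ^ Z n \<omega>))
           \<longlonglongrightarrow> (if s = 1 then 1
                else 1 - (((1 - s) powr (- \<theta>) + B) / (1 + B)) powr (- 1 / \<theta>)))"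
proof (intro conjI allI impI)
  interpret gw_theta_process M p X \<theta> a c
    by fact
  note A = assms(3) and B = assms(4)
  have "1 + B > 0"
    using \<open>0 \<le> B\<close> by simp
  have lim_powr: "(\<lambda>n. (1 + env_B a c n) powr y) \<longlonglongrightarrow> (1 + B) powr y" for y
    by (intro tendsto_intros B) (use \<open>1 + B > 0\<close> in auto)
  have "(\<lambda>n. env_A a n powr (- 1 / \<theta>)) \<longlonglongrightarrow> 0"
    by (rule tendsto_neg_powr[OF _ A]) (use theta_pos in auto)
  from tendsto_diff[OF tendsto_const tendsto_mult[OF this lim_powr], of 1]
  have "(\<lambda>n. \<P>(\<omega> in M. Z n \<omega> = 0)) \<longlonglongrightarrow> 1"
    unfolding Z_def extinct_prob_eq survival_prob by simp
  then show "extinction_prob M Z = 1"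
    unfolding extinction_prob_def by (rule limI)
  show "(\<lambda>n. \<P>(\<omega> in M. Z n \<omega> > 0))
      \<sim>[sequentially] (\<lambda>n. (1 + B) powr (- 1 / \<theta>) * env_A a n powr (- 1 / \<theta>))"
    \<comment> \<open>Both sides share the factor A_n^(-1/\<theta>). The other factor converges to a
      nonzero constant, which turns convergence into equivalence.\<close>
    unfolding Z_def survival_prob mult.commute[of "env_A a _ powr _"]
    by (intro asymp_equiv_intros tendsto_imp_asymp_equiv_const lim_powr)
      (use \<open>1 + B > 0\<close> in auto)
  show "(\<lambda>n. cond_expectation_on M (\<lambda>\<omega>. Z n \<omega> > 0) (\<lambda>\<omega>. real (Z n \<omega>)))
      \<longlonglongrightarrow> (1 + B) powr (1 / \<theta>)"
    unfolding Z_def cond_expectation_gw_size by (rule lim_powr)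
  fix s :: real
  assume s: "0 \<le> s \<and> s \<le> 1"
  show "(\<lambda>n. cond_expectation_on M (\<lambda>\<omega>. Z n \<omega> > 0) (\<lambda>\<omega>. s ^ Z n \<omega>))
      \<longlonglongrightarrow> (if s = 1 then 1
        else 1 - (((1 - s) powr (- \<theta>) + B) / (1 + B)) powr (- 1 / \<theta>))"
  \<comment> \<open>At s = 1 the power formula would use \<open>0 powr (- \<theta>) = 0\<close> in
    place of infinity, so this point is settled by conditioning the constant 1.\<close>
  proof (cases "s = 1")
    case True
    then show ?thesis
      by (simp add: Z_def cond_expectation_survival_one)
  next
    case False
    with s have "0 < (1 - s) powr (- \<theta>) + B"
      using \<open>0 \<le> B\<close> by (intro add_pos_nonneg) auto
    with \<open>1 + B > 0\<close>
    have "(\<lambda>n. 1 - (((1 - s) powr (- \<theta>) + env_B a c n) / (1 + env_B a c n)) powr (- 1 / \<theta>))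
        \<longlonglongrightarrow> 1 - (((1 - s) powr (- \<theta>) + B) / (1 + B)) powr (- 1 / \<theta>)"
      by (intro tendsto_intros B) auto
    with s False show ?thesis
      by (simp add: Z_def cond_pgf_gw_size)
  qed
qed

end
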